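(* Consider the smooth problem $\min_{x\in\mathbb{R}^n} f(x)$, where $f$ is bounded below and has a nonempty set of minimizers, and where $f$ satisfies the Lipschitz conditions with constants $L_f, L_r, L_c$ given in the context. Let $\{x^k\}_{k\ge 1}$ be generated by the async-parallel block coordinate update with consistent delayed reading described in the context. Assume $T=\mathbb{E}[\mathbf{j}]<\infty$ and take the stepsize such that $$0<\eta<\frac{1/L_c}{1+2\kappa T/\sqrt{m}},\qquad \kappa=\frac{L_r}{L_c}.$$ If $q_0>0$ or $\nabla f(x)$ is bounded for all $x$, then $$\lim_{k\to\infty}\mathbb{E}\|\nabla f(x^k)\|=0,$$ and any limit point of $\{x^k\}_{k\ge1}$ is almost surely a critical point of the problem (i.e. a point $x^*$ with $\nabla f(x^* )=0$).
   Context: The variable $x=(x_1,\dots,x_m)\in\mathbb{R}^n$ is partitioned into $m$ disjoint blocks; $\nabla_i f$ is the partial gradient with respect to block $i$; $U_i y$ is the vector in $\mathbb{R}^n$ whose $i$-th block is $y_i$ and whose other blocks are zero; $\|\cdot\|$ is the Euclidean norm. $f$ is differentiable (possibly nonconvex). Lipschitz conditions: for all $x,y$ and all $i\in\{1,\dots,m\}$, $\|\nabla f(x)-\nabla f(y)\|\le L_f\|x-y\|$, $\|\nabla f(x)-\nabla f(x+U_iy)\|\le L_r\|y_i\|$, $\|\nabla_i f(x)-\nabla_i f(x+U_iy)\|\le L_c\|y_i\|$. Algorithm (smooth case): given any point $x^0\in\mathbb{R}^n$ and stepsize $\eta>0$, for $k=0,1,2,\dots$ a block index $i_k$ is selected uniformly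 at random from $\{1,\dots,m\}$, and $$x^{k+1}=x^k-\eta\,U_{i_k}\nabla f(\hat x^k),$$ where $\hat x^k$ is the (possibly outdated) value of the variable that was read. The reading is consistent and delayed by $j_k$, namely $\hat x^k=x^{k-j_k}$, with the convention $x^k=x^0$ for $k<0$. Each delay $j_k$ follows an identical distribution as a random variable $\mathbf{j}$ with $\mathrm{Prob}(\mathbf{j}=t)=q_t$, $t=0,1,2,\dots$ (possibly unbounded), and $j_k$ is independent of $i_k$. *)

theory Defs
  imports "HOL-Probability.Probability"
begin

text \<open>Coordinates of \<open>real ^ 'n\<close> are partitioned into the blocks \<open>B 1, \<dots>, B m\<close>; values
  \<open>B i\<close> for \<open>i\<close> outside \<open>{1..m}\<close> play no role.\<close>

definition block_partition :: "nat \<Rightarrow> (nat \<Rightarrow> 'n set) \<Rightarrow> bool" where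
  "block_partition m B \<longleftrightarrow>
     (\<forall>i\<in>{1..m}. B i \<noteq> {}) \<and> disjoint_family_on B {1..m} \<and> (\<Union>i\<in>{1..m}. B i) = UNIV"

definition block_embed :: "(nat \<Rightarrow> 'n set) \<Rightarrow> nat \<Rightarrow> real ^ 'n \<Rightarrow> real ^ ('n::finite)" where
  "block_embed B i y = (\<chi> l. if l \<in> B i then y $ l else 0)"

text \<open>Euclidean norm of the subvector \<open>y\<^sub>i\<close>. The partial gradient with respect to block \<open>i\<close>
  is the \<open>i\<close>-th block of the gradient, so its norm is the \<open>block_norm\<close> of the gradient.\<close>

definition block_norm :: "(nat \<Rightarrow> 'n set) \<Rightarrow> nat \<Rightarrow> real ^ ('n::finite) \<Rightarrow> real" where
  "block_norm B i y = L2_set (\<lambda>l. y $ l) (B i)"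

definition block_lipschitz ::
  "nat \<Rightarrow> (nat \<Rightarrow> 'n set) \<Rightarrow> (real ^ 'n \<Rightarrow> real ^ ('n::finite)) \<Rightarrow> real \<Rightarrow> real \<Rightarrow> real \<Rightarrow> bool" where
  "block_lipschitz m B gradf L\<^sub>f L\<^sub>r L\<^sub>c \<longleftrightarrow>
     (\<forall>x y. norm (gradf x - gradf y) \<le> L\<^sub>f * norm (x - y)) \<and>
     (\<forall>x y. \<forall>i\<in>{1..m}.
        norm (gradf x - gradf (x + block_embed B i y)) \<le> L\<^sub>r * block_norm B i y) \<and>
     (\<forall>x y. \<forall>i\<in>{1..m}.
        block_norm B i (gradf x - gradf (x + block_embed B i y)) \<le> L\<^sub>c * block_norm B i y)"

text \<open>Here \<open>ik k\<close> is the block selected and \<open>jk k\<close> the delay at step \<open>k\<close>. Truncated subtraction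
  on \<open>nat\<close> implements the convention that iterates with negative index equal the initial point.\<close>

definition async_bcu_iterates ::
  "'w measure \<Rightarrow> (nat \<Rightarrow> 'n set) \<Rightarrow> (real ^ 'n \<Rightarrow> real ^ ('n::finite)) \<Rightarrow> real \<Rightarrow> real ^ 'n \<Rightarrow>
   (nat \<Rightarrow> 'w \<Rightarrow> nat) \<Rightarrow> (nat \<Rightarrow> 'w \<Rightarrow> nat) \<Rightarrow> (nat \<Rightarrow> 'w \<Rightarrow> real ^ 'n) \<Rightarrow> bool" where
  "async_bcu_iterates M B gradf \<eta> x0 ik jk x \<longleftrightarrow>
     (\<forall>\<omega>\<in>space M. x 0 \<omega> = x0 \<and>
       (\<forall>k. x (Suc k) \<omega> =
          x k \<omega> - \<eta> *\<^sub>R block_embed B (ik k \<omega>) (gradf (x (k - jk k \<omega>) \<omega>))))"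

text \<open>Independence of two random variables with possibly different value types
  (\<open>prob_space.indep_var\<close> requires a common one).\<close>

definition indep_pair ::
  "'w measure \<Rightarrow> 'a measure \<Rightarrow> ('w \<Rightarrow> 'a) \<Rightarrow> 'b measure \<Rightarrow> ('w \<Rightarrow> 'b) \<Rightarrow> bool" where
  "indep_pair M N X P Y \<longleftrightarrow>
     X \<in> measurable M N \<and> Y \<in> measurable M P \<and>
     prob_space.indep_set M
       {X -` A \<inter> space M |A. A \<in> sets N} {Y -` A \<inter> space M |A. A \<in> sets P}"

text \<open>The block is uniform on \<open>{1..m}\<close>, the delay has law \<open>q\<close>, the two are independent of each
  other, and the pair is independent of the iterates \<open>x 0, \<dots>, x k\<close> computed so far. The
  delays need not be independent of one another.\<close>

definition random_block_and_delay ::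
  "'w measure \<Rightarrow> nat \<Rightarrow> nat pmf \<Rightarrow> (nat \<Rightarrow> 'w \<Rightarrow> nat) \<Rightarrow> (nat \<Rightarrow> 'w \<Rightarrow> nat) \<Rightarrow>
   (nat \<Rightarrow> 'w \<Rightarrow> real ^ ('n::finite)) \<Rightarrow> bool" where
  "random_block_and_delay M m q ik jk x \<longleftrightarrow>
     (\<forall>k. ik k \<in> measurable M (count_space UNIV) \<and>
          distr M (count_space UNIV) (ik k) = measure_pmf (pmf_of_set {1..m}) \<and>
          jk k \<in> measurable M (count_space UNIV) \<and>
          distr M (count_space UNIV) (jk k) = measure_pmf q \<and>
          prob_space.indep_var M (count_space UNIV) (ik k) (count_space UNIV) (jk k) \<and>
          indep_pair M
            (count_space UNIV) (\<lambda>\<omega>. (ik k \<omega>, jk k \<omega>))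
            (PiM {..k} (\<lambda>_. borel)) (\<lambda>\<omega>. \<lambda>l\<in>{..k}. x l \<omega>))"

end

theory Submission
  imports Defs
begin

text \<open>Everything follows from \<open>\<Sum>k. E (norm (\<nabla>f (x\<^sub>k)))\<^sup>2 < \<infinity>\<close> (lemma \<open>summable_sq_grad\<close>).
  Convergence of the expected norm is then Jensen's inequality. Moreover, almost every path has
  square summable gradients, so \<open>\<nabla>f (x\<^sub>k) \<longrightarrow> 0\<close> almost surely, and by continuity of the gradient
  every limit point is critical.

  Write \<open>a\<^sub>k = E (norm (\<nabla>f (x\<^sub>k)))\<^sup>2\<close> and \<open>D\<^sub>k = E (norm (x\<^sub>k\<^sub>+\<^sub>1 - x\<^sub>k))\<^sup>2\<close>. The descent inequality for
  one block (\<open>block_descent\<close>) bounds \<open>E f (x\<^sub>k\<^sub>+\<^sub>1) - E f (x\<^sub>k)\<close> by \<open>L\<^sub>c D\<^sub>k / 2\<close> minus \<open>\<eta>\<close> times the expected inner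
  product of \<open>\<nabla>f (x\<^sub>k)\<close> with the chosen block of the stale gradient. Averaging over that block, which
  is independent of the delay and the past (\<open>expectation_block_delay\<close>), turns this inner product into
  \<open>E (\<nabla>f (x\<^sub>k) \<bullet> \<nabla>f (x\<^sub>k\<^sub>-\<^sub>j)) / m\<close>. Replacing the stale gradient by the current one costs
  \<open>L\<^sub>r\<close> times the length of the path from \<open>x\<^sub>k\<^sub>-\<^sub>j\<close> to \<open>x\<^sub>k\<close>, since each step moves a single block. Young's
  inequality with weight \<open>\<eta> / \<surd>m\<close> splits the product of that length with \<open>norm (\<nabla>f (x\<^sub>k))\<close>, in expectation, into a
  multiple of \<open>j a\<^sub>k\<close> and a multiple of the sum of the \<open>D\<^sub>d\<close> over the window \<open>k - j \<le> d < k\<close>.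

  Pairing the path with the current gradient, and not with the stale one, is what makes a
  finite first moment of the delay suffice. In the sum over \<open>k\<close>, each index \<open>d\<close> lies in at most \<open>t\<close>
  windows of length \<open>t\<close>, which gives the factor \<open>T = E j\<close> (\<open>sum_window_le\<close>). Likewise, shifting the index by a
  delay \<open>t\<close> truncated at 0 adds at most \<open>t\<close> extra copies of \<open>a\<^sub>0\<close> (\<open>sum_shift_le\<close>), so the identity
  \<open>D\<^sub>k = \<eta>\<^sup>2 / m * E a\<^sub>k\<^sub>-\<^sub>j\<close> gives \<open>\<Sum> D\<^sub>k \<le> \<eta>\<^sup>2 / m * (\<Sum> a\<^sub>k + T a\<^sub>0)\<close>. In the total, the coefficient
  of \<open>\<Sum> a\<^sub>k\<close> is \<open>- \<eta> / m * (1 - \<eta> L\<^sub>c (1 + 2 \<kappa> T / \<surd>m) / 2)\<close>, at most \<open>- \<eta> / (2 m)\<close> by the choice of the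
  stepsize, while the telescoped left side \<open>E f (x\<^sub>K) - f (x\<^sub>0)\<close> is bounded below by \<open>min f - f (x\<^sub>0)\<close>.\<close>

section \<open>Blocks of coordinates\<close>

lemma block_norm_eq_norm_block_embed: "block_norm B i y = norm (block_embed B i y)"
  unfolding block_norm_def block_embed_def norm_vec_def L2_set_def
  by (simp add: if_distrib[of "\<lambda>t. t^2"] if_distrib[of norm] sum.If_cases cong: if_cong)

lemma inner_block_embed:
  "u \<bullet> block_embed B i v = block_embed B i u \<bullet> block_embed B i v"
  unfolding inner_vec_def block_embed_def by (intro sum.cong) auto

lemma inner_block_embed_self: "y \<bullet> block_embed B i y = (norm (block_embed B i y))\<^sup>2"
  by (subst inner_block_embed) (simp add: power2_norm_eq_inner)

lemma norm_block_embed_le: "norm (block_embed B i y) \<le> norm y"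
proof (cases "norm (block_embed B i y) = 0")
  case False
  have "(norm (block_embed B i y))\<^sup>2 \<le> norm y * norm (block_embed B i y)"
    using norm_cauchy_schwarz[of y "block_embed B i y"] by (simp add: inner_block_embed_self)
  with False show ?thesis by (simp add: power2_eq_square)
qed simp

lemma block_embed_scaleR: "block_embed B i (c *\<^sub>R y) = c *\<^sub>R block_embed B i y"
  unfolding block_embed_def by (auto simp: vec_eq_iff)

lemma sum_block_embed:
  assumes "block_partition m B"
  shows "(\<Sum>i=1..m. block_embed B i y) = y"
proof (subst vec_eq_iff, safe)
  fix l
  from assms obtain i0 where i0: "i0 \<in> {1..m}" "l \<in> B i0"
    unfolding block_partition_def by blast
  have "(\<Sum>i=1..m. block_embed B i y $ l) = (\<Sum>i=1..m. if i = i0 then y $ l else 0)"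
  proof (intro sum.cong refl)
    fix i assume "i \<in> {1..m}"
    then have "l \<in> B i \<longleftrightarrow> i = i0"
      using assms i0 unfolding block_partition_def disjoint_family_on_def by blast
    then show "block_embed B i y $ l = (if i = i0 then y $ l else 0)"
      by (simp add: block_embed_def)
  qed
  also have "\<dots> = y $ l" using i0 by simp
  finally show "(\<Sum>i=1..m. block_embed B i y) $ l = y $ l" by simp
qed

lemma sum_inner_block_embed:
  assumes "block_partition m B"
  shows "(\<Sum>i=1..m. u \<bullet> block_embed B i y) = u \<bullet> y"
  by (simp add: inner_sum_right[symmetric] sum_block_embed[OF assms] del: One_nat_def)

lemma sum_norm_block_embed:
  assumes "block_partition m B"
  shows "(\<Sum>i=1..m. (norm (block_embed B i y))\<^sup>2) = (norm y)\<^sup>2"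
  using sum_inner_block_embed[OF assms, of y y]
  by (simp add: inner_block_embed_self power2_norm_eq_inner)

lemma block_partition_imp_pos:
  assumes "block_partition m (B :: nat \<Rightarrow> 'n set)"
  shows "0 < m"
  using assms unfolding block_partition_def by (cases m) auto

text \<open>A block is nonempty, so it contains a unit vector; a Lipschitz bound along a unit
  vector has a nonnegative right-hand side.\<close>

lemma block_lipschitz_nonneg:
  fixes B :: "nat \<Rightarrow> 'n::finite set"
  assumes "block_partition m B" "block_lipschitz m B gradf L\<^sub>f L\<^sub>r L\<^sub>c"
  shows "0 \<le> L\<^sub>r" "0 \<le> L\<^sub>c"
proof -
  from block_partition_imp_pos[OF assms(1)] have 1: "1 \<in> {1..m}" by simp
  then obtain l where l: "l \<in> B 1" using assms(1) unfolding block_partition_def by blast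
  define e :: "real ^ 'n" where "e = axis l 1"
  have "block_embed B 1 e = e"
    using l unfolding e_def block_embed_def axis_def by (auto simp: vec_eq_iff)
  then have e: "block_norm B 1 e = 1"
    unfolding block_norm_eq_norm_block_embed by (simp add: e_def norm_axis_1)
  have "norm (gradf 0 - gradf (0 + block_embed B 1 e)) \<le> L\<^sub>r * block_norm B 1 e"
    and "block_norm B 1 (gradf 0 - gradf (0 + block_embed B 1 e)) \<le> L\<^sub>c * block_norm B 1 e"
    using assms(2) 1 unfolding block_lipschitz_def by blast+
  then show "0 \<le> L\<^sub>r" "0 \<le> L\<^sub>c"
    unfolding e by (auto intro: order_trans[OF norm_ge_zero] simp: block_norm_eq_norm_block_embed)
qed

text \<open>Along a segment inside one block only the block component of the gradient enters the
  derivative of \<open>f\<close>, so the quadratic upper bound holds with the block constant \<open>L\<^sub>c\<close>.\<close>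

lemma block_descent:
  assumes grad: "\<And>y. GDERIV f y :> gradf y"
    and lip: "block_lipschitz m B gradf L\<^sub>f L\<^sub>r L\<^sub>c" and i: "i \<in> {1..m}"
  shows "f (z + block_embed B i y)
       \<le> f z + gradf z \<bullet> block_embed B i y + L\<^sub>c / 2 * (norm (block_embed B i y))\<^sup>2"
proof -
  define h where "h = block_embed B i y"
  \<comment> \<open>The claim is \<open>\<phi> 1 \<le> \<phi> 0\<close>, and the Lipschitz bound says that the derivative of \<open>\<phi>\<close>
    on \<open>[0, 1]\<close> is nonpositive.\<close>
  define \<phi> where "\<phi> s = f (z + s *\<^sub>R h) - s * (gradf z \<bullet> h) - L\<^sub>c / 2 * s\<^sup>2 * (norm h)\<^sup>2" for s
  have deriv: "(\<phi> has_real_derivative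
      ((gradf (z + s *\<^sub>R h) - gradf z) \<bullet> h - L\<^sub>c * s * (norm h)\<^sup>2)) (at s)" for s
  proof -
    have "((\<lambda>s. f (z + s *\<^sub>R h)) has_derivative (\<lambda>t. (t *\<^sub>R h) \<bullet> gradf (z + s *\<^sub>R h))) (at s)"
      by (rule has_derivative_compose[where f = "\<lambda>s. z + s *\<^sub>R h"
            and g' = "\<lambda>v. v \<bullet> gradf (z + s *\<^sub>R h)"])
        (use grad in \<open>auto simp: gderiv_def intro!: derivative_eq_intros\<close>)
    then have "((\<lambda>s. f (z + s *\<^sub>R h)) has_real_derivative gradf (z + s *\<^sub>R h) \<bullet> h) (at s)"
      by (simp add: has_field_derivative_def inner_commute mult.commute[of _ "inner _ _"])
    then show ?thesis
      unfolding \<phi>_def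
      by (auto intro!: derivative_eq_intros simp: inner_diff_left power2_eq_square algebra_simps)
  qed
  have "\<phi> 1 \<le> \<phi> 0"
  proof (rule DERIV_nonpos_imp_nonincreasing[where f = \<phi>])
    fix s :: real assume s: "0 \<le> s" "s \<le> 1"
    define D where "D = gradf (z + s *\<^sub>R h) - gradf z"
    have "block_norm B i (gradf z - gradf (z + block_embed B i (s *\<^sub>R y)))
        \<le> L\<^sub>c * block_norm B i (s *\<^sub>R y)"
      using lip i unfolding block_lipschitz_def by blast
    then have "norm (block_embed B i (gradf z - gradf (z + s *\<^sub>R h))) \<le> L\<^sub>c * (s * norm h)"
      using s by (simp add: block_norm_eq_norm_block_embed block_embed_scaleR h_def)
    moreover have "block_embed B i (gradf z - gradf (z + s *\<^sub>R h)) = - block_embed B i D"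
      using block_embed_scaleR[of B i "-1" D] by (simp add: D_def)
    ultimately have *: "norm (block_embed B i D) \<le> L\<^sub>c * (s * norm h)" by simp
    have "D \<bullet> h \<le> norm (block_embed B i D) * norm h"
      unfolding h_def by (subst inner_block_embed) (rule norm_cauchy_schwarz)
    also have "\<dots> \<le> L\<^sub>c * (s * norm h) * norm h"
      by (intro mult_right_mono *) simp
    finally have "D \<bullet> h - L\<^sub>c * s * (norm h)\<^sup>2 \<le> 0"
      by (simp add: power2_eq_square mult.assoc)
    with deriv[of s] show "\<exists>d. (\<phi> has_real_derivative d) (at s) \<and> d \<le> 0"
      unfolding D_def by blast
  qed simp
  then show ?thesis by (simp add: \<phi>_def h_def)
qed

section \<open>Independence and product laws\<close>

text \<open>The counterpart of \<open>indep_var_distribution_eq\<close> for random variables whose value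
  types differ; it opens the way to Fubini's theorem.\<close>

lemma (in prob_space) indep_pair_distribution:
  assumes "indep_pair M N X P Y"
  shows "distr M N X \<Otimes>\<^sub>M distr M P Y = distr M (N \<Otimes>\<^sub>M P) (\<lambda>\<omega>. (X \<omega>, Y \<omega>))"
proof -
  have [measurable]: "X \<in> measurable M N" "Y \<in> measurable M P"
    and ind: "indep_set {X -` A \<inter> space M |A. A \<in> sets N} {Y -` A \<inter> space M |A. A \<in> sets P}"
    using assms unfolding indep_pair_def by auto
  show ?thesis
  proof (rule pair_measure_eqI)
    show "sigma_finite_measure (distr M N X)" "sigma_finite_measure (distr M P Y)"
      by (auto intro!: prob_space_imp_sigma_finite prob_space_distr)
    fix A B assume "A \<in> sets (distr M N X)" "B \<in> sets (distr M P Y)"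
    then have AB [measurable]: "A \<in> sets N" "B \<in> sets P" by auto
    have "prob ((X -` A \<inter> space M) \<inter> (Y -` B \<inter> space M))
        = prob (X -` A \<inter> space M) * prob (Y -` B \<inter> space M)"
      using AB by (intro indep_setD[OF ind]) auto
    moreover have "(\<lambda>\<omega>. (X \<omega>, Y \<omega>)) -` (A \<times> B) \<inter> space M
        = (X -` A \<inter> space M) \<inter> (Y -` B \<inter> space M)"
      by auto
    ultimately show "emeasure (distr M N X) A * emeasure (distr M P Y) B
        = emeasure (distr M (N \<Otimes>\<^sub>M P) (\<lambda>\<omega>. (X \<omega>, Y \<omega>))) (A \<times> B)"
      by (simp add: emeasure_distr emeasure_eq_measure ennreal_mult'')
  qed simp
qed

section \<open>Sums along random delays\<close>

text \<open>After exchanging the sums, \<open>b d\<close> is counted once for each window \<open>{k - t..<k}\<close> that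
  contains \<open>d\<close>, that is, for \<open>d < k \<le> d + t\<close>: at most \<open>t\<close> times.\<close>

lemma sum_window_le:
  fixes b :: "nat \<Rightarrow> real"
  assumes "\<And>k. 0 \<le> b k"
  shows "(\<Sum>k<K. \<Sum>d=k - t..<k. b d) \<le> real t * (\<Sum>k<K. b k)"
proof -
  have "(\<Sum>k<K. \<Sum>d=k - t..<k. b d) = (\<Sum>k<K. \<Sum>d<K. if k - t \<le> d \<and> d < k then b d else 0)"
  proof (rule sum.cong[OF refl])
    fix k assume "k \<in> {..<K}"
    then have "{k - t..<k} = {d \<in> {..<K}. k - t \<le> d \<and> d < k}" by auto
    then show "(\<Sum>d=k - t..<k. b d) = (\<Sum>d<K. if k - t \<le> d \<and> d < k then b d else 0)"
      by (simp only: sum.inter_filter[OF finite_lessThan])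
  qed
  also have "\<dots> = (\<Sum>d<K. \<Sum>k<K. if k - t \<le> d \<and> d < k then b d else 0)"
    by (rule sum.swap)
  also have "\<dots> \<le> (\<Sum>d<K. real t * b d)"
  proof (rule sum_mono)
    fix d
    have "(\<Sum>k<K. if k - t \<le> d \<and> d < k then b d else 0)
        = real (card {k \<in> {..<K}. k - t \<le> d \<and> d < k}) * b d"
      by (simp add: sum.inter_filter[symmetric])
    also have "card {k \<in> {..<K}. k - t \<le> d \<and> d < k} \<le> card {d<..d + t}"
      by (intro card_mono) auto
    then have "real (card {k \<in> {..<K}. k - t \<le> d \<and> d < k}) * b d \<le> real t * b d"
      using assms by (intro mult_right_mono) auto
    finally show "(\<Sum>k<K. if k - t \<le> d \<and> d < k then b d else 0) \<le> real t * b d" .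
  qed
  finally show ?thesis by (simp add: sum_distrib_left)
qed

text \<open>Each unit of delay pushes one more term to the truncated index 0.\<close>

lemma sum_shift_le:
  fixes b :: "nat \<Rightarrow> real"
  assumes "\<And>k. 0 \<le> b k"
  shows "(\<Sum>k<K. b (k - t)) \<le> (\<Sum>k<K. b k) + real t * b 0"
proof (induction t)
  case (Suc t)
  have "(\<Sum>k<K. b (k - Suc t)) \<le> (\<Sum>k<K. b (k - t)) + b 0"
  proof (cases K)
    case (Suc n)
    have "(\<Sum>k<K. b (k - Suc t)) = b 0 + (\<Sum>k<n. b (k - t))"
      unfolding Suc sum.lessThan_Suc_shift[of _ n] by simp
    then show ?thesis using assms[of "n - t"] by (simp add: Suc)
  qed (simp add: assms)
  with Suc show ?case by (simp add: algebra_simps)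
qed simp

lemma integrable_window:
  fixes b :: "nat \<Rightarrow> real"
  assumes "\<And>k. 0 \<le> b k"
  shows "integrable (measure_pmf q) (\<lambda>t. \<Sum>d=k - t..<k. b d)"
  by (rule measure_pmf.integrable_const_bound[of _ "\<Sum>d<k. b d"])
     (auto simp: assms sum_nonneg intro!: sum_mono2)

lemma integrable_shift:
  fixes b :: "nat \<Rightarrow> real"
  assumes "\<And>k. 0 \<le> b k"
  shows "integrable (measure_pmf q) (\<lambda>t. b (k - t))"
  by (rule measure_pmf.integrable_const_bound[of _ "\<Sum>d\<le>k. b d"])
     (auto simp: assms intro!: member_le_sum)

lemma expectation_window_le:
  fixes b :: "nat \<Rightarrow> real"
  assumes "\<And>k. 0 \<le> b k" and "integrable (measure_pmf q) real"
  shows "(\<Sum>k<K. measure_pmf.expectation q (\<lambda>t. \<Sum>d=k - t..<k. b d))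
       \<le> measure_pmf.expectation q real * (\<Sum>k<K. b k)"
proof -
  have "(\<Sum>k<K. measure_pmf.expectation q (\<lambda>t. \<Sum>d=k - t..<k. b d))
      = measure_pmf.expectation q (\<lambda>t. \<Sum>k<K. \<Sum>d=k - t..<k. b d)"
    by (rule Bochner_Integration.integral_sum[symmetric]) (rule integrable_window[OF assms(1)])
  also have "\<dots> \<le> measure_pmf.expectation q (\<lambda>t. real t * (\<Sum>k<K. b k))"
    using assms by (intro integral_mono Bochner_Integration.integrable_sum integrable_window
        integrable_mult_left sum_window_le)
  finally show ?thesis using assms(2) by simp
qed

lemma expectation_shift_le:
  fixes b :: "nat \<Rightarrow> real"
  assumes "\<And>k. 0 \<le> b k" and "integrable (measure_pmf q) real"
  shows "(\<Sum>k<K. measure_pmf.expectation q (\<lambda>t. b (k - t)))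
       \<le> (\<Sum>k<K. b k) + measure_pmf.expectation q real * b 0"
proof -
  have "(\<Sum>k<K. measure_pmf.expectation q (\<lambda>t. b (k - t)))
      = measure_pmf.expectation q (\<lambda>t. \<Sum>k<K. b (k - t))"
    by (rule Bochner_Integration.integral_sum[symmetric]) (rule integrable_shift[of b, OF assms(1)])
  also have "\<dots> \<le> measure_pmf.expectation q (\<lambda>t. (\<Sum>k<K. b k) + real t * b 0)"
    using assms by (intro integral_mono Bochner_Integration.integrable_sum integrable_shift
        Bochner_Integration.integrable_add integrable_mult_left sum_shift_le) auto
  finally show ?thesis using assms(2) by simp
qed

section \<open>The asynchronous iteration\<close>

locale async_bcu = prob_space M
  for M :: "'w measure" +
  fixes f :: "real ^ ('n::finite) \<Rightarrow> real"
    and gradf :: "real ^ 'n \<Rightarrow> real ^ 'n"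
    and m :: nat and B :: "nat \<Rightarrow> 'n set"
    and L\<^sub>f L\<^sub>r L\<^sub>c \<eta> :: real
    and q :: "nat pmf"
    and ik jk :: "nat \<Rightarrow> 'w \<Rightarrow> nat"
    and x0 :: "real ^ 'n"
    and x :: "nat \<Rightarrow> 'w \<Rightarrow> real ^ 'n"
  assumes partition: "block_partition m B"
    and gradient: "\<And>y. GDERIV f y :> gradf y"
    and lipschitz: "block_lipschitz m B gradf L\<^sub>f L\<^sub>r L\<^sub>c"
    and iterates: "async_bcu_iterates M B gradf \<eta> x0 ik jk x"
    and sampling: "random_block_and_delay M m q ik jk x"
    and \<eta>_pos: "0 < \<eta>"
begin

text \<open>The iterates computed before step \<open>k\<close> as one random element of a finite product space;
  block and delay of step \<open>k\<close> are jointly independent of it.\<close>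

definition history :: "nat \<Rightarrow> 'w \<Rightarrow> nat \<Rightarrow> real ^ 'n" where
  "history k \<omega> = (\<lambda>l\<in>{..k}. x l \<omega>)"

lemma m_pos: "0 < m"
  using block_partition_imp_pos[OF partition] .

lemmas L_nonneg = block_lipschitz_nonneg[OF partition lipschitz]

lemma x_0: "\<omega> \<in> space M \<Longrightarrow> x 0 \<omega> = x0"
  and x_Suc: "\<omega> \<in> space M \<Longrightarrow>
    x (Suc k) \<omega> = x k \<omega> - \<eta> *\<^sub>R block_embed B (ik k \<omega>) (gradf (x (k - jk k \<omega>) \<omega>))"
  using iterates unfolding async_bcu_iterates_def by auto

lemma measurable_block [measurable]: "ik k \<in> measurable M (count_space UNIV)"
  and measurable_delay [measurable]: "jk k \<in> measurable M (count_space UNIV)"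
  and distr_block: "distr M (count_space UNIV) (ik k) = measure_pmf (pmf_of_set {1..m})"
  and distr_delay: "distr M (count_space UNIV) (jk k) = measure_pmf q"
  and indep_block_delay: "indep_var (count_space UNIV) (ik k) (count_space UNIV) (jk k)"
  using sampling unfolding random_block_and_delay_def by auto

lemma history_apply [simp]: "l \<le> k \<Longrightarrow> history k \<omega> l = x l \<omega>"
  by (simp add: history_def)

lemma indep_history:
  "indep_pair M (count_space UNIV) (\<lambda>\<omega>. (ik k \<omega>, jk k \<omega>)) (PiM {..k} (\<lambda>_. borel)) (history k)"
  using sampling unfolding random_block_and_delay_def history_def[abs_def] by auto

lemma measurable_history [measurable]:
  "history k \<in> measurable M (PiM {..k} (\<lambda>_. borel))"
  using indep_history unfolding indep_pair_def by blast

lemma measurable_x [measurable]: "x k \<in> borel_measurable M"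
proof -
  have "(\<lambda>\<omega>. history k \<omega> k) \<in> borel_measurable M" by measurable
  then show ?thesis by simp
qed

lemma continuous_gradf: "continuous_on UNIV gradf"
proof -
  have "norm (gradf a - gradf b) \<le> \<bar>L\<^sub>f\<bar> * norm (a - b)" for a b
  proof -
    have "norm (gradf a - gradf b) \<le> L\<^sub>f * norm (a - b)"
      using lipschitz unfolding block_lipschitz_def by blast
    also have "\<dots> \<le> \<bar>L\<^sub>f\<bar> * norm (a - b)" by (intro mult_right_mono) auto
    finally show ?thesis .
  qed
  then have "\<bar>L\<^sub>f\<bar>-lipschitz_on UNIV gradf"
    by (intro lipschitz_onI) (auto simp: dist_norm)
  then show ?thesis by (rule lipschitz_on_continuous_on)
qed

lemma measurable_gradf [measurable]: "gradf \<in> borel_measurable borel"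
  by (rule borel_measurable_continuous_onI[OF continuous_gradf])

lemma measurable_f [measurable]: "f \<in> borel_measurable borel"
  by (rule borel_measurable_continuous_onI)
    (use gradient in \<open>auto simp: gderiv_def continuous_on_eq_continuous_within
        intro: has_derivative_continuous has_derivative_at_withinI\<close>)

lemma measurable_block_embed [measurable]: "block_embed B i \<in> borel_measurable borel"
proof -
  have "linear (block_embed B i :: real ^ 'n \<Rightarrow> _)"
    by (rule linearI) (auto simp: block_embed_def vec_eq_iff)
  then show ?thesis
    by (intro borel_measurable_continuous_onI linear_continuous_on linear_conv_bounded_linear[THEN iffD1])
qed

text \<open>The delay is truncated to \<open>{0..k}\<close> and there are finitely many sets of coordinates, so
  the start determines finitely many possible values of each iterate. This makes every
  function of finitely many iterates bounded, and integrability comes for free.\<close>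

lemma finite_range_x: "finite (x k ` space M)"
proof (induction k rule: less_induct)
  case (less k)
  show ?case
  proof (cases k)
    case 0
    have "x 0 ` space M \<subseteq> {x0}" by (auto simp: x_0)
    then show ?thesis unfolding 0 by (rule finite_subset) simp
  next
    case (Suc n)
    let ?R = "\<Union>l\<in>{..n}. x l ` space M"
    have "x k ` space M \<subseteq> (\<lambda>(u, S, v). u - \<eta> *\<^sub>R (\<chi> l. if l \<in> S then gradf v $ l else 0))
                          ` (?R \<times> UNIV \<times> ?R)"
    proof safe
      fix \<omega> assume \<omega>: "\<omega> \<in> space M"
      show "x k \<omega> \<in> (\<lambda>(u, S, v). u - \<eta> *\<^sub>R (\<chi> l. if l \<in> S then gradf v $ l else 0))
                          ` (?R \<times> UNIV \<times> ?R)"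
        by (rule image_eqI[where x = "(x n \<omega>, B (ik n \<omega>), x (n - jk n \<omega>) \<omega>)"])
          (use \<omega> in \<open>auto simp: Suc x_Suc block_embed_def\<close>)
    qed
    moreover have "finite (?R \<times> (UNIV :: 'n set set) \<times> ?R)" using less Suc by auto
    ultimately show ?thesis by (rule finite_surj[rotated])
  qed
qed

lemma bounded_along_history:
  fixes h :: "real ^ 'n \<Rightarrow> 'b::real_normed_vector"
  obtains C where "0 \<le> C" "\<And>l \<omega>. l \<le> k \<Longrightarrow> \<omega> \<in> space M \<Longrightarrow> norm (h (x l \<omega>)) \<le> C"
proof -
  have "finite (\<Union>l\<in>{..k}. (\<lambda>y. norm (h y)) ` x l ` space M)"
    using finite_range_x by auto
  then have "bdd_above (\<Union>l\<in>{..k}. (\<lambda>y. norm (h y)) ` x l ` space M)"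
    by (rule bdd_above_finite)
  then obtain C where C: "\<And>l \<omega>. l \<le> k \<Longrightarrow> \<omega> \<in> space M \<Longrightarrow> norm (h (x l \<omega>)) \<le> C"
    unfolding bdd_above_def by fastforce
  show ?thesis
    by (rule that[of "max 0 C"]) (use C in \<open>auto simp: le_max_iff_disj\<close>)
qed

lemma integrable_x:
  fixes h :: "real ^ 'n \<Rightarrow> real"
  assumes [measurable]: "h \<in> borel_measurable borel"
  shows "integrable M (\<lambda>\<omega>. h (x k \<omega>))"
proof -
  obtain C where "\<And>l \<omega>. l \<le> k \<Longrightarrow> \<omega> \<in> space M \<Longrightarrow> norm (h (x l \<omega>)) \<le> C"
    by (rule bounded_along_history[of k h]) blast
  then show ?thesis by (intro integrable_const_bound[of _ C]) auto
qed

text \<open>Conditioning on the past: the joint law of block, delay and history is a product, so by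
  Fubini the history may be integrated first with block and delay held fixed, then the block is
  averaged over its uniform law and the delay over \<open>q\<close>.\<close>

lemma expectation_block_delay:
  fixes \<Phi> :: "nat \<Rightarrow> nat \<Rightarrow> (nat \<Rightarrow> real ^ 'n) \<Rightarrow> real"
  assumes [measurable]: "\<And>i t. \<Phi> i t \<in> borel_measurable (PiM {..k} (\<lambda>_. borel))"
    and bound: "\<And>i t \<omega>. \<omega> \<in> space M \<Longrightarrow> \<bar>\<Phi> i t (history k \<omega>)\<bar> \<le> C"
  shows "expectation (\<lambda>\<omega>. \<Phi> (ik k \<omega>) (jk k \<omega>) (history k \<omega>))
       = measure_pmf.expectation q
           (\<lambda>t. (\<Sum>i=1..m. expectation (\<lambda>\<omega>. \<Phi> i t (history k \<omega>))) / real m)"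
proof -
  let ?P = "PiM {..k} (\<lambda>_. borel) :: (nat \<Rightarrow> real ^ 'n) measure"
  let ?Z = "\<lambda>\<omega>. (ik k \<omega>, jk k \<omega>)"
  let ?I = "measure_pmf (pmf_of_set {1..m})"
  let ?LZ = "distr M (count_space UNIV) ?Z" and ?LH = "distr M ?P (history k)"
  let ?F = "\<lambda>(z, h). \<Phi> (fst z) (snd z) h"
  have N: "count_space UNIV \<Otimes>\<^sub>M count_space UNIV = (count_space UNIV :: (nat \<times> nat) measure)"
    by (simp add: pair_measure_countable)
  have [measurable]: "?Z \<in> measurable M (count_space UNIV)"
    using indep_history unfolding indep_pair_def by blast
  have F [measurable]: "?F \<in> borel_measurable (count_space UNIV \<Otimes>\<^sub>M ?P)"
    by (rule measurable_pair_measure_countable1) auto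
  have law: "?LZ \<Otimes>\<^sub>M ?LH = distr M (count_space UNIV \<Otimes>\<^sub>M ?P) (\<lambda>\<omega>. (?Z \<omega>, history k \<omega>))"
    by (rule indep_pair_distribution[OF indep_history])
  have LZ: "?LZ = ?I \<Otimes>\<^sub>M measure_pmf q"
    using indep_block_delay[of k]
    unfolding indep_var_distribution_eq distr_block distr_delay by (simp add: N)
  interpret LZ: prob_space ?LZ by (rule prob_space_distr) measurable
  interpret LH: prob_space ?LH by (rule prob_space_distr) measurable
  interpret ZH: pair_sigma_finite ?LZ ?LH ..
  interpret IQ: pair_sigma_finite ?I "measure_pmf q" ..
  have intF: "integrable (?LZ \<Otimes>\<^sub>M ?LH) ?F"
    unfolding law using bound
    by (subst integrable_distr_eq) (auto intro!: integrable_const_bound[of _ C])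
  define g where "g = (\<lambda>i t. expectation (\<lambda>\<omega>. \<Phi> i t (history k \<omega>)))"
  have inner: "(\<integral>h. ?F (z, h) \<partial>?LH) = g (fst z) (snd z)" for z
    by (simp add: integral_distr g_def)
  have C: "\<bar>g i t\<bar> \<le> C" for i t
  proof -
    have int: "integrable M (\<lambda>\<omega>. \<Phi> i t (history k \<omega>))"
      using bound by (intro integrable_const_bound[of _ C]) auto
    have "\<bar>g i t\<bar> \<le> expectation (\<lambda>\<omega>. \<bar>\<Phi> i t (history k \<omega>)\<bar>)"
      unfolding g_def by (rule integral_abs_bound)
    also have "\<dots> \<le> expectation (\<lambda>\<omega>. C)"
      using int bound by (intro integral_mono) auto
    finally show ?thesis by (simp add: prob_space)
  qed
  have "expectation (\<lambda>\<omega>. \<Phi> (ik k \<omega>) (jk k \<omega>) (history k \<omega>)) = integral\<^sup>L (?LZ \<Otimes>\<^sub>M ?LH) ?F"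
    unfolding law by (subst integral_distr) auto
  also have "\<dots> = (\<integral>z. g (fst z) (snd z) \<partial>?LZ)"
    unfolding ZH.integral_fst'[OF intF, symmetric] inner ..
  also have "\<dots> = integral\<^sup>L (?I \<Otimes>\<^sub>M measure_pmf q) (\<lambda>(i, t). g i t)"
    by (simp add: LZ case_prod_beta')
  also have "\<dots> = (\<integral>t. (\<integral>i. g i t \<partial>?I) \<partial>measure_pmf q)"
  proof (rule IQ.integral_snd[symmetric])
    show "integrable (?I \<Otimes>\<^sub>M measure_pmf q) (\<lambda>(i, t). g i t)"
      unfolding LZ[symmetric] using C
      by (intro LZ.integrable_const_bound[of _ C]) auto
  qed
  also have "\<dots> = (\<integral>t. (\<Sum>i=1..m. g i t) / real m \<partial>measure_pmf q)"
    using m_pos by (simp add: integral_pmf_of_set)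
  finally show ?thesis unfolding g_def .
qed

section \<open>Descent in expectation\<close>

definition sq_grad :: "nat \<Rightarrow> real" where
  "sq_grad k = expectation (\<lambda>\<omega>. (norm (gradf (x k \<omega>)))\<^sup>2)"

definition sq_step :: "nat \<Rightarrow> real" where
  "sq_step k = expectation (\<lambda>\<omega>. (norm (x (Suc k) \<omega> - x k \<omega>))\<^sup>2)"

lemma sq_grad_nonneg [simp]: "0 \<le> sq_grad k" and sq_step_nonneg [simp]: "0 \<le> sq_step k"
  by (simp_all add: sq_grad_def sq_step_def)

lemma AE_block_in_range: "AE \<omega> in M. \<forall>k. ik k \<omega> \<in> {1..m}"
proof (subst AE_all_countable, safe)
  fix k
  have "AE i in distr M (count_space UNIV) (ik k). i \<in> {1..m}"
    unfolding distr_block using m_pos by (auto simp: AE_measure_pmf_iff set_pmf_of_set)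
  then show "AE \<omega> in M. ik k \<omega> \<in> {1..m}"
    by (subst (asm) AE_distr_iff) auto
qed

text \<open>A step changes one block, so \<open>L\<^sub>r\<close> governs the change of the whole gradient.\<close>

lemma gradient_step_le:
  assumes "\<omega> \<in> space M" "ik d \<omega> \<in> {1..m}"
  shows "norm (gradf (x (Suc d) \<omega>) - gradf (x d \<omega>)) \<le> L\<^sub>r * norm (x (Suc d) \<omega> - x d \<omega>)"
proof -
  define y where "y = (- \<eta>) *\<^sub>R gradf (x (d - jk d \<omega>) \<omega>)"
  have eq: "x (Suc d) \<omega> = x d \<omega> + block_embed B (ik d \<omega>) y"
    unfolding y_def block_embed_scaleR using x_Suc[OF assms(1)] by simp
  have "norm (gradf (x d \<omega>) - gradf (x d \<omega> + block_embed B (ik d \<omega>) y))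
      \<le> L\<^sub>r * block_norm B (ik d \<omega>) y"
    using lipschitz assms(2) unfolding block_lipschitz_def by blast
  then show ?thesis
    by (simp add: eq block_norm_eq_norm_block_embed norm_minus_commute)
qed

lemma gradient_delay_le:
  assumes "\<omega> \<in> space M" "\<forall>k. ik k \<omega> \<in> {1..m}"
  shows "norm (gradf (x k \<omega>) - gradf (x (k - t) \<omega>))
       \<le> L\<^sub>r * (\<Sum>d=k - t..<k. norm (x (Suc d) \<omega> - x d \<omega>))"
proof -
  have "gradf (x k \<omega>) - gradf (x (k - t) \<omega>)
      = (\<Sum>d=k - t..<k. gradf (x (Suc d) \<omega>) - gradf (x d \<omega>))"
    by (rule sum_Suc_diff'[of "k - t" k "\<lambda>d. gradf (x d \<omega>)", symmetric]) simp
  also have "norm \<dots> \<le> (\<Sum>d=k - t..<k. L\<^sub>r * norm (x (Suc d) \<omega> - x d \<omega>))"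
    using assms by (intro order_trans[OF norm_sum] sum_mono gradient_step_le) auto
  finally show ?thesis by (simp add: sum_distrib_left)
qed

text \<open>Write \<open>u \<bullet> v = u \<bullet> u - u \<bullet> (u - v)\<close> and apply Young's inequality with weight \<open>c\<close> to each
  product \<open>norm u * \<delta> d\<close>. Here \<open>u\<close> is the current and \<open>v\<close> the stale gradient, and the \<open>\<delta> d\<close> are the
  lengths of the steps in between.\<close>

lemma inner_ge_of_perturbation:
  fixes u v :: "'a::real_inner" and \<delta> :: "'b \<Rightarrow> real"
  assumes "norm (u - v) \<le> L * (\<Sum>d\<in>A. \<delta> d)" "0 \<le> L" "0 < c"
  shows "(norm u)\<^sup>2 - L / 2 * (\<Sum>d\<in>A. c * (norm u)\<^sup>2 + (\<delta> d)\<^sup>2 / c) \<le> u \<bullet> v"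
proof -
  have young: "norm u * \<delta> d \<le> (c * (norm u)\<^sup>2 + (\<delta> d)\<^sup>2 / c) / 2" for d
  proof -
    have "0 \<le> (c * norm u - \<delta> d)\<^sup>2 / c" using assms(3) by simp
    then show ?thesis using assms(3) by (simp add: power2_eq_square field_simps)
  qed
  have "u \<bullet> (u - v) \<le> norm u * norm (u - v)" by (rule norm_cauchy_schwarz)
  also have "\<dots> \<le> norm u * (L * (\<Sum>d\<in>A. \<delta> d))"
    by (intro mult_left_mono assms(1)) simp
  also have "\<dots> = L * (\<Sum>d\<in>A. norm u * \<delta> d)"
    by (simp add: sum_distrib_left mult_ac)
  also have "\<dots> \<le> L * (\<Sum>d\<in>A. (c * (norm u)\<^sup>2 + (\<delta> d)\<^sup>2 / c) / 2)"
    by (intro mult_left_mono sum_mono young assms(2))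
  finally show ?thesis
    by (simp add: inner_diff_right power2_norm_eq_inner sum_divide_distrib[symmetric])
qed

lemma integrable_sq_grad: "integrable M (\<lambda>\<omega>. (norm (gradf (x k \<omega>)))\<^sup>2)"
  by (rule integrable_x) measurable

lemma bounded_step:
  obtains C where "\<And>\<omega>. \<omega> \<in> space M \<Longrightarrow> norm (x (Suc k) \<omega> - x k \<omega>) \<le> C"
proof -
  obtain C where "\<And>l \<omega>. l \<le> Suc k \<Longrightarrow> \<omega> \<in> space M \<Longrightarrow> norm (x l \<omega>) \<le> C"
    by (rule bounded_along_history[of "Suc k" "\<lambda>y. y"]) blast
  then have "norm (x (Suc k) \<omega> - x k \<omega>) \<le> C + C" if "\<omega> \<in> space M" for \<omega>
    using that by (intro order_trans[OF norm_triangle_ineq4] add_mono) auto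
  then show ?thesis by (rule that)
qed

lemma integrable_sq_step: "integrable M (\<lambda>\<omega>. (norm (x (Suc k) \<omega> - x k \<omega>))\<^sup>2)"
proof -
  obtain C where "\<And>\<omega>. \<omega> \<in> space M \<Longrightarrow> norm (x (Suc k) \<omega> - x k \<omega>) \<le> C"
    by (rule bounded_step[of k]) blast
  then show ?thesis
    by (intro integrable_const_bound[of _ "C\<^sup>2"]) (auto intro!: power_mono)
qed

text \<open>The squared norms of the blocks of a vector add up to its squared norm, so a uniformly
  chosen block carries on average the fraction \<open>1 / m\<close> of the squared stale gradient.\<close>

lemma sq_step_eq:
  "sq_step k = \<eta>\<^sup>2 / real m * measure_pmf.expectation q (\<lambda>t. sq_grad (k - t))"
proof -
  let ?\<Phi> = "\<lambda>i t h. (norm (block_embed B i (gradf (h (k - t)))))\<^sup>2 :: real"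
  obtain C where C: "\<And>l \<omega>. l \<le> k \<Longrightarrow> \<omega> \<in> space M \<Longrightarrow> norm (gradf (x l \<omega>)) \<le> C"
    by (rule bounded_along_history[of k gradf]) blast
  have "sq_step k = \<eta>\<^sup>2 * expectation (\<lambda>\<omega>. ?\<Phi> (ik k \<omega>) (jk k \<omega>) (history k \<omega>))"
    unfolding sq_step_def
    by (subst integral_mult_right_zero[symmetric], intro Bochner_Integration.integral_cong)
      (auto simp: x_Suc power_mult_distrib)
  also have "expectation (\<lambda>\<omega>. ?\<Phi> (ik k \<omega>) (jk k \<omega>) (history k \<omega>))
     = measure_pmf.expectation q
         (\<lambda>t. (\<Sum>i=1..m. expectation (\<lambda>\<omega>. ?\<Phi> i t (history k \<omega>))) / real m)"
    by (rule expectation_block_delay[of ?\<Phi> k "C\<^sup>2"])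
      (auto intro!: power_mono order_trans[OF norm_block_embed_le] C)
  also have "\<dots> = measure_pmf.expectation q (\<lambda>t. sq_grad (k - t) / real m)"
  proof (intro Bochner_Integration.integral_cong refl arg_cong2[where f = "(/)"])
    fix t
    have "(\<Sum>i=1..m. expectation (\<lambda>\<omega>. ?\<Phi> i t (history k \<omega>)))
        = expectation (\<lambda>\<omega>. \<Sum>i=1..m. (norm (block_embed B i (gradf (x (k - t) \<omega>))))\<^sup>2)"
      by (subst Bochner_Integration.integral_sum) (auto intro!: integrable_x)
    then show "(\<Sum>i=1..m. expectation (\<lambda>\<omega>. ?\<Phi> i t (history k \<omega>))) = sq_grad (k - t)"
      unfolding sum_norm_block_embed[OF partition] sq_grad_def .
  qed
  finally show ?thesis by simp
qed

lemma integrable_inner_delay: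
  "integrable M (\<lambda>\<omega>. gradf (x k \<omega>) \<bullet> block_embed B i (gradf (x l \<omega>)))"
  "integrable M (\<lambda>\<omega>. gradf (x k \<omega>) \<bullet> gradf (x l \<omega>))"
proof -
  obtain C where "0 \<le> C" and
    C: "\<And>j \<omega>. j \<le> max k l \<Longrightarrow> \<omega> \<in> space M \<Longrightarrow> norm (gradf (x j \<omega>)) \<le> C"
    by (rule bounded_along_history[of "max k l" gradf]) blast
  then show "integrable M (\<lambda>\<omega>. gradf (x k \<omega>) \<bullet> block_embed B i (gradf (x l \<omega>)))"
    by (intro integrable_const_bound[of _ "C * C"])
      (auto intro!: order_trans[OF Cauchy_Schwarz_ineq2] mult_mono order_trans[OF norm_block_embed_le])
  from \<open>0 \<le> C\<close> C show "integrable M (\<lambda>\<omega>. gradf (x k \<omega>) \<bullet> gradf (x l \<omega>))"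
    by (intro integrable_const_bound[of _ "C * C"])
      (auto intro!: order_trans[OF Cauchy_Schwarz_ineq2] mult_mono)
qed

lemma expectation_inner_update:
  "expectation (\<lambda>\<omega>. gradf (x k \<omega>) \<bullet> block_embed B (ik k \<omega>) (gradf (x (k - jk k \<omega>) \<omega>)))
   = measure_pmf.expectation q (\<lambda>t. expectation (\<lambda>\<omega>. gradf (x k \<omega>) \<bullet> gradf (x (k - t) \<omega>))) / real m"
proof -
  let ?\<Phi> = "\<lambda>i t h. gradf (h k) \<bullet> block_embed B i (gradf (h (k - t)))"
  obtain C where "0 \<le> C" and
    C: "\<And>l \<omega>. l \<le> k \<Longrightarrow> \<omega> \<in> space M \<Longrightarrow> norm (gradf (x l \<omega>)) \<le> C"
    by (rule bounded_along_history[of k gradf]) blast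
  have "expectation (\<lambda>\<omega>. ?\<Phi> (ik k \<omega>) (jk k \<omega>) (history k \<omega>))
     = measure_pmf.expectation q
         (\<lambda>t. (\<Sum>i=1..m. expectation (\<lambda>\<omega>. ?\<Phi> i t (history k \<omega>))) / real m)"
    using \<open>0 \<le> C\<close>
    by (intro expectation_block_delay[of ?\<Phi> k "C * C"])
      (auto intro!: order_trans[OF Cauchy_Schwarz_ineq2] mult_mono C
        order_trans[OF norm_block_embed_le])
  moreover have "(\<Sum>i=1..m. expectation (\<lambda>\<omega>. ?\<Phi> i t (history k \<omega>)))
      = expectation (\<lambda>\<omega>. gradf (x k \<omega>) \<bullet> gradf (x (k - t) \<omega>))" for t
  proof -
    have "(\<Sum>i=1..m. expectation (\<lambda>\<omega>. ?\<Phi> i t (history k \<omega>)))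
        = expectation (\<lambda>\<omega>. \<Sum>i=1..m. gradf (x k \<omega>) \<bullet> block_embed B i (gradf (x (k - t) \<omega>)))"
      by (subst Bochner_Integration.integral_sum) (auto intro!: integrable_inner_delay)
    then show ?thesis by (simp only: sum_inner_block_embed[OF partition])
  qed
  ultimately show ?thesis by simp
qed

lemma expectation_inner_delay_ge:
  assumes "0 < c"
  shows "sq_grad k - L\<^sub>r / 2 * (\<Sum>d=k - t..<k. c * sq_grad k + sq_step d / c)
       \<le> expectation (\<lambda>\<omega>. gradf (x k \<omega>) \<bullet> gradf (x (k - t) \<omega>))"
proof -
  let ?R = "\<lambda>\<omega>. (norm (gradf (x k \<omega>)))\<^sup>2 - L\<^sub>r / 2 * (\<Sum>d=k - t..<k.
        c * (norm (gradf (x k \<omega>)))\<^sup>2 + (norm (x (Suc d) \<omega> - x d \<omega>))\<^sup>2 / c)"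
  note int = integrable_sq_grad integrable_sq_step
  have "sq_grad k - L\<^sub>r / 2 * (\<Sum>d=k - t..<k. c * sq_grad k + sq_step d / c) = expectation ?R"
    unfolding sq_grad_def sq_step_def
    by (simp add: int Bochner_Integration.integral_diff Bochner_Integration.integral_sum)
  also have "\<dots> \<le> expectation (\<lambda>\<omega>. gradf (x k \<omega>) \<bullet> gradf (x (k - t) \<omega>))"
  proof (rule integral_mono_AE)
    show "integrable M ?R" by (simp add: int)
    show "AE \<omega> in M. ?R \<omega> \<le> gradf (x k \<omega>) \<bullet> gradf (x (k - t) \<omega>)"
      using AE_block_in_range AE_space
    proof eventually_elim
      case (elim \<omega>)
      show ?case
        by (rule inner_ge_of_perturbation[OF gradient_delay_le L_nonneg(1) assms]) (use elim in auto)
    qed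
  qed (rule integrable_inner_delay)
  finally show ?thesis .
qed

lemma expected_descent:
  "expectation (\<lambda>\<omega>. f (x (Suc k) \<omega>))
   \<le> expectation (\<lambda>\<omega>. f (x k \<omega>))
     - \<eta> * expectation (\<lambda>\<omega>. gradf (x k \<omega>) \<bullet> block_embed B (ik k \<omega>) (gradf (x (k - jk k \<omega>) \<omega>)))
     + L\<^sub>c / 2 * sq_step k"
proof -
  let ?in = "\<lambda>\<omega>. gradf (x k \<omega>) \<bullet> block_embed B (ik k \<omega>) (gradf (x (k - jk k \<omega>) \<omega>))"
  let ?R = "\<lambda>\<omega>. f (x k \<omega>) - \<eta> * ?in \<omega> + L\<^sub>c / 2 * (norm (x (Suc k) \<omega> - x k \<omega>))\<^sup>2"
  have in_eq: "?in \<omega> = - (gradf (x k \<omega>) \<bullet> (x (Suc k) \<omega> - x k \<omega>)) / \<eta>" if "\<omega> \<in> space M" for \<omega>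
    using that \<eta>_pos by (simp add: x_Suc)
  have int_in: "integrable M ?in"
  proof -
    obtain C where "0 \<le> C" and
      C: "\<And>l \<omega>. l \<le> k \<Longrightarrow> \<omega> \<in> space M \<Longrightarrow> norm (gradf (x l \<omega>)) \<le> C"
      by (rule bounded_along_history[of k gradf]) blast
    have "?in \<in> borel_measurable M"
      by (subst measurable_cong[OF in_eq]) auto
    with \<open>0 \<le> C\<close> C show ?thesis
      by (intro integrable_const_bound[of _ "C * C"])
        (auto intro!: order_trans[OF Cauchy_Schwarz_ineq2] mult_mono
          order_trans[OF norm_block_embed_le])
  qed
  have int_f: "integrable M (\<lambda>\<omega>. f (x l \<omega>))" for l
    by (rule integrable_x) measurable
  note int = int_f int_in integrable_sq_step
  have "expectation (\<lambda>\<omega>. f (x (Suc k) \<omega>)) \<le> expectation ?R"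
  proof (rule integral_mono_AE)
    show "integrable M (\<lambda>\<omega>. f (x (Suc k) \<omega>))" "integrable M ?R" by (simp_all add: int)
    show "AE \<omega> in M. f (x (Suc k) \<omega>) \<le> ?R \<omega>"
      using AE_block_in_range AE_space
    proof eventually_elim
      case (elim \<omega>)
      define y where "y = (- \<eta>) *\<^sub>R gradf (x (k - jk k \<omega>) \<omega>)"
      have "block_embed B (ik k \<omega>) y = x (Suc k) \<omega> - x k \<omega>"
        unfolding y_def block_embed_scaleR using elim by (simp add: x_Suc)
      with block_descent[OF gradient lipschitz, of "ik k \<omega>" "x k \<omega>" y] elim
      have "f (x (Suc k) \<omega>) \<le> f (x k \<omega>) + gradf (x k \<omega>) \<bullet> (x (Suc k) \<omega> - x k \<omega>)
          + L\<^sub>c / 2 * (norm (x (Suc k) \<omega> - x k \<omega>))\<^sup>2"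
        by simp
      moreover have "gradf (x k \<omega>) \<bullet> (x (Suc k) \<omega> - x k \<omega>) = - (\<eta> * ?in \<omega>)"
        using in_eq[of \<omega>] elim \<eta>_pos by simp
      ultimately show ?case by simp
    qed
  qed
  also have "\<dots> = expectation (\<lambda>\<omega>. f (x k \<omega>)) - \<eta> * expectation ?in + L\<^sub>c / 2 * sq_step k"
    unfolding sq_step_def using int by simp
  finally show ?thesis .
qed

section \<open>Summability of the squared gradients\<close>

text \<open>The window contains at most \<open>t\<close> indices, so the Young terms with the current gradient
  sum to at most \<open>c T\<close> times its expected square; the expected window sum of the squared
  steps is kept for the summation over \<open>k\<close>.\<close>

lemma descent_step:
  assumes "integrable (measure_pmf q) real" "0 < c"
  defines "T \<equiv> measure_pmf.expectation q real"
  shows "expectation (\<lambda>\<omega>. f (x (Suc k) \<omega>))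
   \<le> expectation (\<lambda>\<omega>. f (x k \<omega>))
     - \<eta> / real m * ((1 - L\<^sub>r * c * T / 2) * sq_grad k
         - L\<^sub>r / (2 * c) * measure_pmf.expectation q (\<lambda>t. \<Sum>d=k - t..<k. sq_step d))
     + L\<^sub>c / 2 * sq_step k"
proof -
  define W where "W = measure_pmf.expectation q (\<lambda>t. \<Sum>d=k - t..<k. sq_step d)"
  note int_W = integrable_window[of sq_step q k, OF sq_step_nonneg]
  let ?low = "\<lambda>t. (1 - L\<^sub>r * c / 2 * real t) * sq_grad k - L\<^sub>r / (2 * c) * (\<Sum>d=k - t..<k. sq_step d)"
  have "(1 - L\<^sub>r * c * T / 2) * sq_grad k - L\<^sub>r / (2 * c) * W = measure_pmf.expectation q ?low"
    using assms(1) int_W unfolding T_def W_def by (simp add: algebra_simps)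
  also have "\<dots> \<le> measure_pmf.expectation q
      (\<lambda>t. expectation (\<lambda>\<omega>. gradf (x k \<omega>) \<bullet> gradf (x (k - t) \<omega>)))"
  proof (rule integral_mono)
    show "integrable (measure_pmf q) ?low"
      using assms(1) int_W by simp
    let ?g = "\<lambda>l. expectation (\<lambda>\<omega>. gradf (x k \<omega>) \<bullet> gradf (x l \<omega>))"
    \<comment> \<open>The function takes only the values \<open>?g 0, \<dots>, ?g k\<close>.\<close>
    show "integrable (measure_pmf q) (\<lambda>t. ?g (k - t))"
      by (rule measure_pmf.integrable_const_bound[of _ "\<Sum>l\<le>k. \<bar>?g l\<bar>"])
        (auto intro!: member_le_sum[of _ _ "\<lambda>l. \<bar>?g l\<bar>"])
    fix t
    have "L\<^sub>r / 2 * (real (k - (k - t)) * (c * sq_grad k)) \<le> L\<^sub>r / 2 * (real t * (c * sq_grad k))"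
      using L_nonneg assms(2) by (intro mult_left_mono mult_right_mono) auto
    then have "?low t \<le> sq_grad k - L\<^sub>r / 2 * (\<Sum>d=k - t..<k. c * sq_grad k + sq_step d / c)"
      by (simp add: sum.distrib sum_divide_distrib[symmetric] algebra_simps)
    also note expectation_inner_delay_ge[OF assms(2)]
    finally show "?low t \<le> ?g (k - t)" .
  qed
  also have "\<dots> = real m * expectation
      (\<lambda>\<omega>. gradf (x k \<omega>) \<bullet> block_embed B (ik k \<omega>) (gradf (x (k - jk k \<omega>) \<omega>)))"
    unfolding expectation_inner_update using m_pos by simp
  finally have "\<eta> / real m * ((1 - L\<^sub>r * c * T / 2) * sq_grad k - L\<^sub>r / (2 * c) * W)
      \<le> \<eta> / real m * (real m * expectation
      (\<lambda>\<omega>. gradf (x k \<omega>) \<bullet> block_embed B (ik k \<omega>) (gradf (x (k - jk k \<omega>) \<omega>))))"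
    using \<eta>_pos by (intro mult_left_mono) auto
  with expected_descent[of k] m_pos show ?thesis
    unfolding W_def by simp
qed

text \<open>The weight \<open>c = \<eta> / \<surd>m\<close> is the one that balances Young's inequality: a squared step is on
  average \<open>\<eta>\<^sup>2 / m = c\<^sup>2\<close> times a squared gradient, so that both halves of the delay error come to
  \<open>p / 2\<close> times \<open>\<eta> / m * \<Sum>k<K. sq_grad k\<close>, up to a constant that does not depend on \<open>K\<close>. The
  stepsize condition says precisely that \<open>\<eta> L\<^sub>c / 2 + p\<close> is below \<open>1 / 2\<close>.\<close>

lemma summable_sq_grad:
  assumes T_fin: "integrable (measure_pmf q) real"
    and lower: "\<And>y. f_min \<le> f y"
    and stepsize: "\<eta> * L\<^sub>c + 2 * \<eta> * L\<^sub>r * measure_pmf.expectation q real / sqrt (real m) < 1"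
  shows "summable sq_grad"
proof -
  define T where "T = measure_pmf.expectation q real"
  define c where "c = \<eta> / sqrt (real m)"
  define p where "p = L\<^sub>r * c * T"
  have sm: "sqrt (real m) > 0" "sqrt (real m) * sqrt (real m) = real m" using m_pos by auto
  have c_pos: "0 < c" using \<eta>_pos sm by (simp add: c_def)
  have T_nonneg: "0 \<le> T" unfolding T_def by simp
  have p_small: "\<eta> * L\<^sub>c / 2 + p \<le> 1 / 2"
    using stepsize unfolding p_def c_def T_def by (simp add: mult_ac)
  have p_nonneg: "0 \<le> p" using L_nonneg c_pos T_nonneg by (simp add: p_def)
  have bound: "(\<Sum>k<K. sq_grad k) \<le> 2 * real m / \<eta> * (f x0 - f_min) + T * sq_grad 0" for K
  proof -
    define F where "F k = expectation (\<lambda>\<omega>. f (x k \<omega>))" for k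
    define W where "W k = measure_pmf.expectation q (\<lambda>t. \<Sum>d=k - t..<k. sq_step d)" for k
    define S SD where "S = (\<Sum>k<K. sq_grad k)" and "SD = (\<Sum>k<K. sq_step k)"
    have "(\<Sum>k<K. F (Suc k) - F k)
        \<le> (\<Sum>k<K. - (\<eta> / real m * ((1 - p / 2) * sq_grad k - L\<^sub>r / (2 * c) * W k))
            + L\<^sub>c / 2 * sq_step k)"
      using descent_step[OF T_fin c_pos, folded T_def]
      unfolding F_def W_def p_def by (intro sum_mono) (simp add: algebra_simps)
    then have "F K - F 0 \<le> - (\<eta> / real m * ((1 - p / 2) * S - L\<^sub>r / (2 * c) * (\<Sum>k<K. W k)))
            + L\<^sub>c / 2 * SD"
      unfolding sum_lessThan_telescope S_def SD_def
      by (simp only: sum.distrib sum_subtractf sum_negf sum_distrib_left[symmetric])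
    also have "\<dots> \<le> - (\<eta> / real m * ((1 - p / 2) * S - L\<^sub>r / (2 * c) * (T * SD))) + L\<^sub>c / 2 * SD"
      using expectation_window_le[of sq_step, OF sq_step_nonneg T_fin] L_nonneg c_pos \<eta>_pos
      unfolding W_def T_def SD_def
      by (intro add_right_mono le_imp_neg_le mult_left_mono diff_left_mono) auto
    also have "\<dots> = - (\<eta> / real m * (1 - p / 2) * S) + (p + \<eta> * L\<^sub>c) / (2 * \<eta>) * SD"
    proof -
      have "\<eta> / (s * s) * (L\<^sub>r / (2 * (\<eta> / s)) * (T * SD)) = L\<^sub>r * (\<eta> / s) * T / (2 * \<eta>) * SD"
        if "0 < s" for s
        using that \<eta>_pos by (simp add: field_simps)
      from this[OF sm(1)]
      have window: "\<eta> / real m * (L\<^sub>r / (2 * c) * (T * SD)) = p / (2 * \<eta>) * SD"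
        unfolding sm(2) p_def c_def .
      have "(p + \<eta> * L\<^sub>c) / (2 * \<eta>) * SD = p / (2 * \<eta>) * SD + L\<^sub>c / 2 * SD"
        using \<eta>_pos by (simp add: field_simps)
      then show ?thesis unfolding right_diff_distrib[of _ "(1 - p / 2) * S"] window
        by (simp add: mult.assoc)
    qed
    also have "\<dots> \<le> - (\<eta> / real m * (1 - p / 2) * S)
        + (p + \<eta> * L\<^sub>c) / (2 * \<eta>) * (\<eta>\<^sup>2 / real m * (S + T * sq_grad 0))"
    proof (intro add_left_mono mult_left_mono)
      have "SD = \<eta>\<^sup>2 / real m * (\<Sum>k<K. measure_pmf.expectation q (\<lambda>t. sq_grad (k - t)))"
        unfolding SD_def sq_step_eq by (simp add: sum_distrib_left)
      also have "\<dots> \<le> \<eta>\<^sup>2 / real m * (S + T * sq_grad 0)"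
        unfolding S_def T_def
        by (intro mult_left_mono expectation_shift_le T_fin) auto
      finally show "SD \<le> \<eta>\<^sup>2 / real m * (S + T * sq_grad 0)" .
    qed (use p_nonneg L_nonneg \<eta>_pos in auto)
    also have "\<dots> = \<eta> / real m * ((p / 2 + \<eta> * L\<^sub>c / 2) * (S + T * sq_grad 0) - (1 - p / 2) * S)"
      using \<eta>_pos m_pos by (simp add: field_simps power2_eq_square)
    also have "\<dots> \<le> \<eta> / real m * (1 / 2 * (T * sq_grad 0) - 1 / 2 * S)"
    proof (intro mult_left_mono)
      have "0 \<le> S" unfolding S_def by (simp add: sum_nonneg)
      then have "(\<eta> * L\<^sub>c / 2 + p) * S \<le> 1 / 2 * S" by (intro mult_right_mono p_small)
      moreover have "(p / 2 + \<eta> * L\<^sub>c / 2) * (T * sq_grad 0) \<le> 1 / 2 * (T * sq_grad 0)"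
        using p_small p_nonneg T_nonneg by (intro mult_right_mono) auto
      ultimately show "(p / 2 + \<eta> * L\<^sub>c / 2) * (S + T * sq_grad 0) - (1 - p / 2) * S
          \<le> 1 / 2 * (T * sq_grad 0) - 1 / 2 * S"
        by (simp add: algebra_simps)
    qed (use \<eta>_pos in auto)
    finally have "\<eta> / real m * (1 / 2 * S) \<le> F 0 - F K
        + \<eta> / real m * (1 / 2 * (T * sq_grad 0))"
      by (simp add: algebra_simps)
    moreover have "F 0 = f x0"
    proof -
      have "F 0 = expectation (\<lambda>\<omega>. f x0)"
        unfolding F_def by (intro Bochner_Integration.integral_cong) (auto simp: x_0)
      then show ?thesis by (simp add: prob_space)
    qed
    moreover have "f_min \<le> F K"
    proof -
      have "expectation (\<lambda>\<omega>. f_min) \<le> F K"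
        unfolding F_def by (intro integral_mono integrable_x lower) auto
      then show ?thesis by (simp add: prob_space)
    qed
    ultimately have "\<eta> / real m * (1 / 2 * S)
        \<le> f x0 - f_min + \<eta> / real m * (1 / 2 * (T * sq_grad 0))"
      by linarith
    then show ?thesis
      using \<eta>_pos m_pos unfolding S_def by (simp add: field_simps)
  qed
  show ?thesis
    by (rule bounded_imp_summable[OF sq_grad_nonneg
          bound[of "Suc n" for n, unfolded lessThan_Suc_atMost]])
qed

lemma tendsto_expectation_norm_gradient:
  assumes "summable sq_grad"
  shows "(\<lambda>k. expectation (\<lambda>\<omega>. norm (gradf (x k \<omega>)))) \<longlonglongrightarrow> 0"
proof (rule tendsto_sandwich[of "\<lambda>_. 0" _ _ "\<lambda>k. sqrt (sq_grad k)"])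
  have "expectation (\<lambda>\<omega>. norm (gradf (x k \<omega>))) \<le> sqrt (sq_grad k)" for k
  proof (rule real_le_rsqrt)
    have "integrable M (\<lambda>\<omega>. norm (gradf (x k \<omega>)))" by (rule integrable_x) measurable
    from variance_eq[OF this integrable_sq_grad] variance_positive
    show "(expectation (\<lambda>\<omega>. norm (gradf (x k \<omega>))))\<^sup>2 \<le> sq_grad k"
      unfolding sq_grad_def by (metis diff_ge_0_iff_ge)
  qed
  then show "\<forall>\<^sub>F k in sequentially. expectation (\<lambda>\<omega>. norm (gradf (x k \<omega>))) \<le> sqrt (sq_grad k)"
    by simp
  show "(\<lambda>k. sqrt (sq_grad k)) \<longlonglongrightarrow> 0"
    using tendsto_real_sqrt[OF summable_LIMSEQ_zero[OF assms]] by simp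
qed auto

text \<open>By monotone convergence the sum of the squared gradients along a path has finite
  expectation, hence is finite for almost every path.\<close>

lemma AE_gradient_tendsto_zero:
  assumes "summable sq_grad"
  shows "AE \<omega> in M. (\<lambda>k. gradf (x k \<omega>)) \<longlonglongrightarrow> 0"
proof -
  let ?Y = "\<lambda>k \<omega>. (norm (gradf (x k \<omega>)))\<^sup>2"
  have "(\<integral>\<^sup>+\<omega>. (\<Sum>k. ennreal (?Y k \<omega>)) \<partial>M) = (\<Sum>k. \<integral>\<^sup>+\<omega>. ennreal (?Y k \<omega>) \<partial>M)"
    by (rule nn_integral_suminf) measurable
  also have "\<dots> = (\<Sum>k. ennreal (sq_grad k))"
    unfolding sq_grad_def
    by (intro suminf_cong nn_integral_eq_integral integrable_sq_grad) auto
  also have "\<dots> \<noteq> \<infinity>"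
    using assms by (simp add: suminf_ennreal_eq[OF _ summable_sums])
  finally have "AE \<omega> in M. (\<Sum>k. ennreal (?Y k \<omega>)) \<noteq> \<infinity>"
    by (intro nn_integral_PInf_AE) measurable
  then show ?thesis
  proof eventually_elim
    case (elim \<omega>)
    then have "summable (\<lambda>k. ?Y k \<omega>)" by (intro summable_suminf_not_top) auto
    from tendsto_real_sqrt[OF summable_LIMSEQ_zero[OF this]]
    show ?case by (simp add: tendsto_norm_zero_iff)
  qed
qed

end

section \<open>Convergence of the gradients\<close>

theorem theorem2:
  fixes f :: "real ^ ('n::finite) \<Rightarrow> real"
    and gradf :: "real ^ 'n \<Rightarrow> real ^ 'n"
    and m :: nat and B :: "nat \<Rightarrow> 'n set"
    and L\<^sub>f L\<^sub>r L\<^sub>c \<eta> \<kappa> T :: real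
    and q :: "nat pmf"
    and M :: "'w measure"
    and ik jk :: "nat \<Rightarrow> 'w \<Rightarrow> nat"
    and x0 :: "real ^ 'n"
    and x :: "nat \<Rightarrow> 'w \<Rightarrow> real ^ 'n"
  assumes "block_partition m B"
    and "\<forall>y. GDERIV f y :> gradf y"
    and "bdd_below (range f)"
    and "\<exists>z. \<forall>y. f z \<le> f y"
    and "block_lipschitz m B gradf L\<^sub>f L\<^sub>r L\<^sub>c"
    and "prob_space M"
    and "async_bcu_iterates M B gradf \<eta> x0 ik jk x"
    and "random_block_and_delay M m q ik jk x"
    and "integrable (measure_pmf q) real"
    and "T = measure_pmf.expectation q real"
    and "\<kappa> = L\<^sub>r / L\<^sub>c"
    and "0 < \<eta>"
    and "\<eta> < (1 / L\<^sub>c) / (1 + 2 * \<kappa> * T / sqrt (real m))"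
    and "pmf q 0 > 0 \<or> bounded (range gradf)"
  shows "(\<forall>k. integrable M (\<lambda>\<omega>. norm (gradf (x k \<omega>)))) \<and>
         (\<lambda>k. \<integral>\<omega>. norm (gradf (x k \<omega>)) \<partial>M) \<longlonglongrightarrow> 0 \<and>
         (AE \<omega> in M. \<forall>z. (\<exists>r. strict_mono r \<and> (\<lambda>k. x (r k) \<omega>) \<longlonglongrightarrow> z) \<longrightarrow> gradf z = 0)"
proof -
  interpret async_bcu M f gradf m B L\<^sub>f L\<^sub>r L\<^sub>c \<eta> q ik jk x0 x
    using assms by (intro async_bcu.intro async_bcu_axioms.intro) auto
  \<comment> \<open>Division by zero yields zero, so \<open>L\<^sub>c = 0\<close> would contradict \<open>0 < \<eta>\<close> through the
    stepsize bound.\<close>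
  have "L\<^sub>c \<noteq> 0" using assms(12,13) by auto
  with L_nonneg have L: "0 \<le> L\<^sub>r" "0 < L\<^sub>c" by auto
  have "0 \<le> T" unfolding assms(10) by simp
  with L have "0 \<le> 2 * \<kappa> * T / sqrt (real m)" unfolding assms(11) by simp
  then have "\<eta> * (L\<^sub>c * (1 + 2 * \<kappa> * T / sqrt (real m))) < 1"
    using assms(13) L by (simp add: less_divide_eq mult_ac)
  moreover have "L\<^sub>r = L\<^sub>c * \<kappa>" using L assms(11) by simp
  ultimately have step: "\<eta> * L\<^sub>c + 2 * \<eta> * L\<^sub>r * T / sqrt (real m) < 1"
    by (simp add: algebra_simps)
  obtain z where "\<forall>y. f z \<le> f y" using assms(4) by blast
  then have sum: "summable sq_grad"
    by (intro summable_sq_grad[OF assms(9) _ step[unfolded assms(10)]]) auto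
  show ?thesis
  proof (intro conjI allI)
    show "integrable M (\<lambda>\<omega>. norm (gradf (x k \<omega>)))" for k
      by (rule integrable_x) measurable
    show "(\<lambda>k. \<integral>\<omega>. norm (gradf (x k \<omega>)) \<partial>M) \<longlonglongrightarrow> 0"
      by (rule tendsto_expectation_norm_gradient[OF sum])
    from AE_gradient_tendsto_zero[OF sum]
    show "AE \<omega> in M. \<forall>z. (\<exists>r. strict_mono r \<and> (\<lambda>k. x (r k) \<omega>) \<longlonglongrightarrow> z) \<longrightarrow> gradf z = 0"
    proof eventually_elim
      case (elim \<omega>)
      show ?case
      proof safe
        fix z r assume r: "strict_mono r" "(\<lambda>k. x (r k) \<omega>) \<longlonglongrightarrow> z"
        have "(\<lambda>k. gradf (x (r k) \<omega>)) \<longlonglongrightarrow> gradf z"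
          by (rule continuous_on_tendsto_compose[OF continuous_gradf r(2)]) auto
        moreover have "(\<lambda>k. gradf (x (r k) \<omega>)) \<longlonglongrightarrow> 0"
          using LIMSEQ_subseq_LIMSEQ[OF elim r(1)] by (simp add: o_def)
        ultimately show "gradf z = 0" by (rule LIMSEQ_unique)
      qed
    qed
  qed
qed

end
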